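(* Let $1/2<\rho<2/3$, let $\eta_0\in X_\rho$, and let $\eta_t$, $h_t$ evolve by the intermediate-density (moving frame) dynamics described in the context, with the associated sequences $p_t=(p_{t,k})_{k\in\mathbb Z}$ and $q_t=(q_{t,k})_{k\in\mathbb Z}$. Then for each $i,k\in\mathbb Z$, $\eta_t(i)$, $h_t(i)$, $p_{t,k}$ and $q_{t,k}$ are eventually constant in $t$. If these limiting values are denoted $\eta_\infty(i)$, $h_\infty(i)$, $p_{\infty,k}$, $q_{\infty,k}$, then $p_\infty$ and $q_\infty$ are the sequences associated with $h_\infty$ (by the same definition), and $\eta_\infty$ is given, for each $k\in\mathbb Z$, by $$\eta_\infty(q_{\infty,k-1}+1)\cdots\eta_\infty(p_{\infty,k})=0\,1\,0\,1\cdots0\,1\,0,$$ $$\eta_\infty(p_{\infty,k}+1)\cdots\eta_\infty(q_{\infty,k})=1\,1\,0\,1\,1\cdots0\,1\,1,$$ i.e. the first string is of the form $(0\,1)^n0$ and the second of the form $1\,1\,(0\,1\,1)^m$, for some integers $n,m\ge0$ depending on $k$. Moreover, for each $k\in\mathbb Z$, $$p_{\infty,k}=q_{0,k}-3\bigl(h_0(p_{0,k})-h_0(q_{0,k})\bigr)+4,$$ $$q_{\infty,k}=p_{0,k+1}-3\bigl(h_0^*(p_{0,k+1})-h_0^*(q_{0,k})\bigr)+3.$$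
   Context: $X=\{0,1\}^{\mathbb Z}$ ($1$ = particle, $0$ = hole); $X_\rho$ is the set of $\eta\in X$ with $\lim_{N\to\infty}\frac1N\sum_{i=1}^N\eta(i)=\lim_{N\to\infty}\frac1N\sum_{i=-N}^{-1}\eta(i)=\rho$. F-TASEP step $U:X\to X$: simultaneously, every particle at a site $j$ with $\eta(j-1)=1$ and $\eta(j+1)=0$ moves to $j+1$. Intermediate-density dynamics: $\eta_{t+1}(k)=(U\eta_t)(k+2)$ (an F-TASEP step followed by a translation by two sites to the left). Height profiles: $h_0(0)=0$, $h_0(k)-h_0(k-1)=(-1)^{\eta_0(k)}$. Given $h_t,\eta_t$, let $H_t(k)=h_t(k)+2$ if $\eta_t(k-1)=\eta_t(k)=1$ and $\eta_t(k+1)=0$, and $H_t(k)=h_t(k)$ otherwise; then $h_{t+1}(k)=H_t(k+2)$. One has $h_t(k)-h_t(k-1)=(-1)^{\eta_t(k)}$ for all $t,k$. Put $h_t^*(k)=h_t(k)+k/3$. Sequences associated with a profile $h$ (of a configuration of density $\rho\in(1/2,2/3)$), with $h^*(k)=h(k)+k/3$: let $A=\{a\in\mathbb Z:h(a)>\sup_{r>a}h(r)\}$ and $B=\{b\in\mathbb Z:h^*(b)<\inf_{r>b}h^*(r)\}$. These are disjoint and unbounded above and below; index them increasingly as $(a_j)_{j\in\mathbb Z}$, $(b_j)_{j\in\mathbb Z}$. Let $P$ be the set of those $a_j\in A$ for which there is a $b\in B$ with $a_{j-1}<b<a_j$, and $Q$ the set of those $b_j\in B$ for which there is an $a\in A$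 with $b_{j-1}<a<b_j$. Points of $P$ and $Q$ alternate; index them as $p=(p_k)_{k\in\mathbb Z}$, $q=(q_k)_{k\in\mathbb Z}$ increasingly with $p_k<q_k<p_{k+1}$ for all $k$ (unique up to a common shift of labels). $p_t,q_t$ are the sequences associated with $h_t$. The indexing at time $0$ is fixed arbitrarily (subject to $p_{0,k}<q_{0,k}<p_{0,k+1}$ for all $k\in\mathbb Z$), and the indexing at later times is the one for which, for all $t\ge0$ and $k$, $h_{t+1}(p_{t+1,k})=h_t(p_{t,k})$ with $p_{t+1,k}\in\{p_{t,k},p_{t,k}-2\}$, and $h^*_{t+1}(q_{t+1,k})=h^*_t(q_{t,k})$ with $q_{t+1,k}\in\{q_{t,k},q_{t,k}-3\}$ (such an indexing exists). *)

theory Defs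
  imports Complex_Main "HOL-Library.Extended_Real"
begin

text \<open>A configuration is a map \<^typ>\<open>int \<Rightarrow> bool\<close>; \<^term>\<open>True\<close> is a particle (1), \<^term>\<open>False\<close> a hole (0).\<close>

type_synonym config = "int \<Rightarrow> bool"

definition X_density :: "real \<Rightarrow> config set" where
  "X_density \<rho> = {\<eta>.
     (\<lambda>N::nat. (\<Sum>i=1..int N. of_bool (\<eta> i)) / real N) \<longlonglongrightarrow> \<rho> \<and>
     (\<lambda>N::nat. (\<Sum>i=-int N..-1. of_bool (\<eta> i)) / real N) \<longlonglongrightarrow> \<rho>}"

definition moves :: "config \<Rightarrow> int \<Rightarrow> bool" where
  "moves \<eta> j \<longleftrightarrow> \<eta> (j - 1) \<and> \<eta> j \<and> \<not> \<eta> (j + 1)"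

definition ftasep_step :: "config \<Rightarrow> config" where
  "ftasep_step \<eta> k \<longleftrightarrow> (\<eta> k \<and> \<not> moves \<eta> k) \<or> moves \<eta> (k - 1)"

definition frame_step :: "config \<Rightarrow> config" where
  "frame_step \<eta> k = ftasep_step \<eta> (k + 2)"

definition height_jump :: "config \<Rightarrow> (int \<Rightarrow> int) \<Rightarrow> int \<Rightarrow> int" where
  "height_jump \<eta> h k = (if moves \<eta> k then h k + 2 else h k)"

definition frame_height_step :: "config \<Rightarrow> (int \<Rightarrow> int) \<Rightarrow> int \<Rightarrow> int" where
  "frame_height_step \<eta> h k = height_jump \<eta> h (k + 2)"

definition is_initial_height :: "config \<Rightarrow> (int \<Rightarrow> int) \<Rightarrow> bool" where
  "is_initial_height \<eta> h \<longleftrightarrow>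
     h 0 = 0 \<and> (\<forall>k. h k - h (k - 1) = (-1) ^ (of_bool (\<eta> k) :: nat))"

definition hstar :: "(int \<Rightarrow> int) \<Rightarrow> int \<Rightarrow> real" where
  "hstar h k = of_int (h k) + of_int k / 3"

text \<open>The supremum and infimum are taken in \<^typ>\<open>ereal\<close>, so that they are meaningful
  also for a profile that is unbounded on the half-line.\<close>

definition A_set :: "(int \<Rightarrow> int) \<Rightarrow> int set" where
  "A_set h = {a. ereal (of_int (h a)) > (SUP r\<in>{a<..}. ereal (of_int (h r)))}"

definition B_set :: "(int \<Rightarrow> int) \<Rightarrow> int set" where
  "B_set h = {b. ereal (hstar h b) < (INF r\<in>{b<..}. ereal (hstar h r))}"

definition enumerates :: "(int \<Rightarrow> int) \<Rightarrow> int set \<Rightarrow> bool" where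
  "enumerates s S \<longleftrightarrow> strict_mono s \<and> range s = S"

text \<open>The enumerations \<^term>\<open>a\<close> and \<^term>\<open>b\<close> are unique up to a shift of labels, on which the two
  sets enumerated by \<^term>\<open>p\<close> and \<^term>\<open>q\<close> do not depend.\<close>

definition associated :: "(int \<Rightarrow> int) \<Rightarrow> (int \<Rightarrow> int) \<Rightarrow> (int \<Rightarrow> int) \<Rightarrow> bool" where
  "associated h p q \<longleftrightarrow>
     (\<exists>a b. enumerates a (A_set h) \<and> enumerates b (B_set h) \<and>
        enumerates p {a j | j. \<exists>c\<in>B_set h. a (j - 1) < c \<and> c < a j} \<and>
        enumerates q {b j | j. \<exists>c\<in>A_set h. b (j - 1) < c \<and> c < b j}) \<and>
     (\<forall>k. p k < q k \<and> q k < p (k + 1))"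

definition consistent_labels ::
    "(int \<Rightarrow> int) \<Rightarrow> (int \<Rightarrow> int) \<Rightarrow> (int \<Rightarrow> int) \<Rightarrow>
     (int \<Rightarrow> int) \<Rightarrow> (int \<Rightarrow> int) \<Rightarrow> (int \<Rightarrow> int) \<Rightarrow> bool" where
  "consistent_labels h p q h' p' q' \<longleftrightarrow>
     (\<forall>k. h' (p' k) = h (p k) \<and> p' k \<in> {p k, p k - 2} \<and>
          hstar h' (q' k) = hstar h (q k) \<and> q' k \<in> {q k, q k - 3})"

end

theory Submission
  imports Defs
begin

text \<open>The labels keep \<open>h(p\<^sub>k)\<close> and \<open>h\<^sup>*(q\<^sub>k)\<close> constant while \<open>p\<^sub>k\<close> and \<open>q\<^sub>k\<close> can only decrease.
  Since \<open>q\<^sub>k\<close> is the last minimum of \<open>h\<^sup>*\<close> on \<open>[p\<^sub>k, \<infinity>)\<close>, and \<open>p\<^sub>k\<close> is followed by two particles,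
  \<open>h\<^sup>*(q\<^sub>k) \<le> h\<^sup>*(p\<^sub>k) - 4/3\<close>; this bounds \<open>p\<^sub>k\<close> below by the limit claimed. Likewise
  \<open>h(q\<^sub>k) < h(p\<^sub>k\<^sub>+\<^sub>1)\<close> bounds \<open>q\<^sub>k\<close> below. So all labels become constant. Once the endpoints of an interval
  no longer move, its contents freeze from the right: the moving frame copies the pattern at
  \<open>p\<^sub>k\<^sub>+\<^sub>1\<close> two sites to the left at each step, and the one at \<open>q\<^sub>k\<close> three sites to the left, until the left
  endpoint is reached. The lengths of the frozen strings then give equality in the two bounds.\<close>

section \<open>Two-sided increasing integer sequences and starts of runs\<close>

lemma strict_mono_intI:
  fixes s :: "int \<Rightarrow> int"
  assumes "\<And>k. s k < s (k + 1)"
  shows "strict_mono s"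
proof (rule strict_monoI)
  fix i j :: int
  have "s i < s (i + 1 + int n)" for n
  proof (induction n)
    case (Suc n)
    also have "s (i + 1 + int n) < s (i + 1 + int (Suc n))"
      using assms[of "i + 1 + int n"] by (simp add: algebra_simps)
    finally show ?case .
  qed (simp add: assms)
  moreover assume "i < j"
  ultimately show "s i < s j"
    by (metis add.commute zless_iff_Suc_zadd of_nat_Suc add.assoc)
qed

lemma strict_mono_int_grows:
  fixes s :: "int \<Rightarrow> int"
  assumes "strict_mono s"
  shows "s i + int n \<le> s (i + int n)"
proof (induction n)
  case (Suc n)
  have "s (i + int n) < s (i + int (Suc n))"
    using assms by (simp add: strict_mono_less)
  with Suc show ?case by simp
qed simp

lemma strict_mono_int_locate:
  fixes s :: "int \<Rightarrow> int"
  assumes "strict_mono s"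
  obtains j where "s j \<le> x" "x < s (j + 1)"
proof -
  \<comment> \<open>Each index changes \<open>s\<close> by at least one, so |s 0 - x| steps to the
    left of index 0 reach a value at most \<open>x\<close>.\<close>
  define i where "i = - \<bar>s 0 - x\<bar>"
  have start: "s i \<le> x"
    using strict_mono_int_grows[OF assms, of i "nat (- i)"] by (auto simp: i_def)
  have "x < s (i + int (nat (x - s i + 1)))"
    using strict_mono_int_grows[OF assms, of i "nat (x - s i + 1)"] start by auto
  then obtain n where n: "x < s (i + int n)" "\<And>m. m < n \<Longrightarrow> \<not> x < s (i + int m)"
    using exists_least_iff[of "\<lambda>n. x < s (i + int n)"] by blast
  with start have "n \<noteq> 0" by (cases n) auto
  then obtain m where "n = Suc m" by (cases n) auto
  with n that[of "i + int m"] show thesis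
    by (force simp: algebra_simps not_less)
qed

text \<open>The set is cut at 0 and its negative half reflected by n = -1 - x. Unboundedness on each
  side makes both halves infinite sets of naturals, which can be enumerated separately.\<close>

lemma enumerates_exists:
  fixes S :: "int set"
  assumes above: "\<And>x. \<exists>y\<in>S. x \<le> y" and below: "\<And>x. \<exists>y\<in>S. y \<le> x"
  shows "\<exists>s. enumerates s S"
proof -
  define U where "U = {n. int n \<in> S}"
  define D where "D = {n. - 1 - int n \<in> S}"
  have U: "infinite U"
    unfolding infinite_nat_iff_unbounded_le
  proof
    fix m
    obtain y where "y \<in> S" "int m \<le> y" using above by blast
    then show "\<exists>n\<ge>m. n \<in> U" by (intro exI[of _ "nat y"]) (auto simp: U_def)
  qed
  have D: "infinite D"
    unfolding infinite_nat_iff_unbounded_le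
  proof
    fix m
    obtain y where "y \<in> S" "y \<le> - 1 - int m" using below by blast
    then show "\<exists>n\<ge>m. n \<in> D" by (intro exI[of _ "nat (- 1 - y)"]) (auto simp: D_def)
  qed
  define s where "s j = (if j \<ge> 0 then int (enumerate U (nat j))
                         else - 1 - int (enumerate D (nat (- 1 - j))))" for j
  have "strict_mono s"
    by (rule strict_monoI) (auto simp: s_def enumerate_mono_iff[OF U] enumerate_mono_iff[OF D])
  moreover have "s j \<in> S" for j
    using enumerate_in_set[OF U, of "nat j"] enumerate_in_set[OF D, of "nat (- 1 - j)"]
    by (auto simp: s_def U_def D_def)
  moreover have "x \<in> range s" if "x \<in> S" for x
  proof (cases "x \<ge> 0")
    case True
    with that have "nat x \<in> U" by (simp add: U_def)
    then obtain n where "enumerate U n = nat x" using range_enumerate[OF U] by (metis imageE)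
    with True have "s (int n) = x" by (simp add: s_def)
    then show ?thesis by (metis rangeI)
  next
    case False
    with that have "nat (- 1 - x) \<in> D" by (simp add: D_def)
    then obtain n where "enumerate D n = nat (- 1 - x)"
      using range_enumerate[OF D] by (metis imageE)
    with False have "s (- 1 - int n) = x" by (simp add: s_def)
    then show ?thesis by (metis rangeI)
  qed
  ultimately show ?thesis unfolding enumerates_def by blast
qed

text \<open>The first point \<open>s (j + 1)\<close> of \<open>S\<close> after \<open>x\<close> has
  \<open>x\<close> in the gap before it, hence is some \<open>u m\<close>, and it lies beyond
  \<open>u k\<close>. Disjointness excludes \<open>x = s j\<close>.\<close>

lemma run_starts_next:
  assumes s: "enumerates s S"
    and u: "enumerates u {s j | j. \<exists>c\<in>T. s (j - 1) < c \<and> c < s j}"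
    and "S \<inter> T = {}" "x \<in> T" "u k < x" "y \<in> S" "x \<le> y"
  shows "u (k + 1) \<le> y"
proof -
  have ms: "strict_mono s" and mu: "strict_mono u" using s u by (auto simp: enumerates_def)
  obtain j where j: "s j \<le> x" "x < s (j + 1)" using strict_mono_int_locate[OF ms] .
  have "s j \<in> S" using s by (auto simp: enumerates_def)
  with assms j have "s j < x" by force
  with j \<open>x \<in> T\<close> have "s (j + 1) \<in> range u" using u by (force simp: enumerates_def)
  then obtain m where m: "u m = s (j + 1)" by force
  with j \<open>u k < x\<close> have "u k < u m" by simp
  then have "u (k + 1) \<le> s (j + 1)"
    using mu m by (metis strict_mono_less strict_mono_less_eq zless_imp_add1_zle)
  moreover obtain i where "y = s i" using s \<open>y \<in> S\<close> by (auto simp: enumerates_def)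
  moreover have "j < i"
    using \<open>s j < x\<close> \<open>x \<le> y\<close> \<open>y = s i\<close> ms by (metis le_less_trans less_le_trans strict_mono_less)
  ultimately show ?thesis
    using ms by (metis order_trans strict_mono_less_eq zless_imp_add1_zle)
qed

text \<open>A converse to \<open>run_starts_next\<close>: alternating points, each the first of its
  kind after its predecessor, exhaust the starts of runs.\<close>

lemma enumerates_run_starts:
  assumes s: "enumerates s S"
    and u: "\<And>k. u k \<in> S" and v: "\<And>k. v k \<in> T"
    and uv: "\<And>k. u k < v k" "\<And>k. v k < u (k + 1)"
    and nextS: "\<And>k y. y \<in> S \<Longrightarrow> v k \<le> y \<Longrightarrow> u (k + 1) \<le> y"
    and nextT: "\<And>k y. y \<in> T \<Longrightarrow> u k \<le> y \<Longrightarrow> v k \<le> y"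
  shows "enumerates u {s j | j. \<exists>c\<in>T. s (j - 1) < c \<and> c < s j}"
proof -
  have mu: "strict_mono u" by (rule strict_mono_intI) (use uv less_trans in blast)
  have mv: "strict_mono v" by (rule strict_mono_intI) (use uv less_trans in blast)
  have ms: "strict_mono s" and rs: "range s = S" using s by (auto simp: enumerates_def)
  have "\<exists>j. u k = s j \<and> (\<exists>c\<in>T. s (j - 1) < c \<and> c < s j)" for k
  proof -
    obtain j where j: "u k = s j" using u rs by blast
    have "s (j - 1) < s j" using ms by (simp add: strict_mono_less)
    moreover have "s (j - 1) \<in> S" using rs by blast
    ultimately have "s (j - 1) < v (k - 1)" using nextS[of "s (j - 1)" "k - 1"] j by force
    moreover have "v (k - 1) < s j" using uv(2)[of "k - 1"] j by simp
    ultimately show ?thesis using j v by blast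
  qed
  moreover have "s j \<in> range u" if c: "c \<in> T" "s (j - 1) < c" "c < s j" for j c
  proof -
    obtain k where k: "v k \<le> c" "c < v (k + 1)" using strict_mono_int_locate[OF mv] .
    \<comment> \<open>The bound \<open>c < v (k + 1)\<close> improves because no point of
      \<open>T\<close> lies in [u (k + 1), v (k + 1)).\<close>
    have lt: "c < u (k + 1)" using nextT[of c "k + 1"] c k by force
    have "u (k + 1) \<le> s j" using nextS[of "s j" k] k c rs by force
    moreover obtain i where i: "u (k + 1) = s i" using u rs by blast
    have "j \<le> i" using i lt c ms by (metis less_trans strict_mono_less zle_diff1_eq linorder_not_le)
    then have "s j \<le> u (k + 1)" using i ms by (simp add: strict_mono_less_eq)
    ultimately show ?thesis by (metis order_antisym rangeI)
  qed
  ultimately show ?thesis unfolding enumerates_def using mu by blast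
qed

section \<open>Pointwise description of \<open>A_set\<close> and \<open>B_set\<close>\<close>

text \<open>Three times \<^term>\<open>hstar\<close>, to stay within the integers.\<close>

definition lift3 :: "(int \<Rightarrow> int) \<Rightarrow> int \<Rightarrow> int" where
  "lift3 h k = 3 * h k + k"

lemma hstar_lift3: "hstar h k = of_int (lift3 h k) / 3"
  by (simp add: hstar_def lift3_def)

lemma mem_A_set_iff: "a \<in> A_set h \<longleftrightarrow> (\<forall>r>a. h r < h a)"
proof
  assume "a \<in> A_set h"
  then have sup: "(SUP r\<in>{a<..}. ereal (of_int (h r))) < ereal (of_int (h a))"
    by (simp add: A_set_def)
  show "\<forall>r>a. h r < h a"
  proof (intro allI impI)
    fix r assume "a < r"
    then have "ereal (of_int (h r)) \<le> (SUP r\<in>{a<..}. ereal (of_int (h r)))"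
      by (intro SUP_upper) simp
    also note sup
    finally show "h r < h a" by simp
  qed
next
  assume less: "\<forall>r>a. h r < h a"
  \<comment> \<open>Integer values turn the strict pointwise bound into a bound by
    \<open>h a - 1\<close>, which survives the supremum.\<close>
  have "(SUP r\<in>{a<..}. ereal (of_int (h r))) \<le> ereal (of_int (h a - 1))"
    using less by (intro SUP_least) (metis ereal_less_eq(3) greaterThan_iff of_int_le_iff zle_diff1_eq)
  also have "\<dots> < ereal (of_int (h a))" by simp
  finally show "a \<in> A_set h" by (simp add: A_set_def)
qed

lemma mem_B_set_iff: "b \<in> B_set h \<longleftrightarrow> (\<forall>r>b. lift3 h b < lift3 h r)"
proof
  assume "b \<in> B_set h"
  then have inf: "ereal (hstar h b) < (INF r\<in>{b<..}. ereal (hstar h r))"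
    by (simp add: B_set_def)
  show "\<forall>r>b. lift3 h b < lift3 h r"
  proof (intro allI impI)
    fix r assume "b < r"
    note inf
    also have "(INF r\<in>{b<..}. ereal (hstar h r)) \<le> ereal (hstar h r)"
      using \<open>b < r\<close> by (intro INF_lower) simp
    finally show "lift3 h b < lift3 h r" by (simp add: hstar_lift3)
  qed
next
  assume less: "\<forall>r>b. lift3 h b < lift3 h r"
  \<comment> \<open>Integrality of \<open>lift3\<close> leaves a margin of 1/3, which survives the
    infimum.\<close>
  have "ereal (hstar h b) < ereal (of_int (lift3 h b + 1) / 3)" by (simp add: hstar_lift3)
  also have "\<dots> \<le> (INF r\<in>{b<..}. ereal (hstar h r))"
  proof (rule INF_greatest)
    fix r assume "r \<in> {b<..}"
    then have "lift3 h b + 1 \<le> lift3 h r" using less by force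
    then have "(of_int (lift3 h b + 1) :: real) \<le> of_int (lift3 h r)" by (rule of_int_le_iff[THEN iffD2])
    then show "ereal (of_int (lift3 h b + 1) / 3) \<le> ereal (hstar h r)" by (simp add: hstar_lift3)
  qed
  finally show "b \<in> B_set h" by (simp add: B_set_def)
qed

lemma A_set_Int_B_set: "A_set h \<inter> B_set h = {}"
proof -
  have False if "a \<in> A_set h" "a \<in> B_set h" for a
  proof -
    have "h (a + 1) < h a" using that(1) by (simp add: mem_A_set_iff)
    moreover have "lift3 h a < lift3 h (a + 1)" using that(2) by (simp add: mem_B_set_iff)
    ultimately show False by (simp add: lift3_def)
  qed
  then show ?thesis by blast
qed

text \<open>A site in [x, a) is outside \<open>A_set h\<close>, so some later site is at least as
  high. Climbing along such sites ends at or beyond \<open>a\<close>, where \<open>a\<close>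
  dominates.\<close>

lemma le_of_no_A_set:
  assumes "a \<in> A_set h" "\<And>y. y \<in> A_set h \<Longrightarrow> x \<le> y \<Longrightarrow> a \<le> y" "x \<le> r"
  shows "h r \<le> h a"
  using assms(3)
proof (induction "nat (a - r)" arbitrary: r rule: less_induct)
  case less
  show ?case
  proof (cases "r < a")
    case True
    with less.prems assms(2) have "r \<notin> A_set h" by force
    then obtain r' where r': "r < r'" "h r \<le> h r'" by (force simp: mem_A_set_iff not_less)
    with less.hyps[of r'] less.prems True show ?thesis by force
  next
    case False
    with assms(1) show ?thesis by (cases "r = a") (auto simp: mem_A_set_iff intro: less_imp_le)
  qed
qed

lemma ge_of_no_B_set:
  assumes "b \<in> B_set h" "\<And>y. y \<in> B_set h \<Longrightarrow> x \<le> y \<Longrightarrow> b \<le> y" "x \<le> r"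
  shows "lift3 h b \<le> lift3 h r"
  using assms(3)
proof (induction "nat (b - r)" arbitrary: r rule: less_induct)
  case less
  show ?case
  proof (cases "r < b")
    case True
    with less.prems assms(2) have "r \<notin> B_set h" by force
    then obtain r' where r': "r < r'" "lift3 h r' \<le> lift3 h r" by (force simp: mem_B_set_iff not_less)
    with less.hyps[of r'] less.prems True show ?thesis by force
  next
    case False
    with assms(1) show ?thesis by (cases "r = b") (auto simp: mem_B_set_iff intro: less_imp_le)
  qed
qed

section \<open>Interlaced sequences\<close>

text \<open>Each condition compares the profile at two sites only, so this characterization of
  \<^const>\<open>associated\<close> passes to pointwise limits.\<close>

definition interlaced :: "(int \<Rightarrow> int) \<Rightarrow> (int \<Rightarrow> int) \<Rightarrow> (int \<Rightarrow> int) \<Rightarrow> bool" where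
  "interlaced h p q \<longleftrightarrow> (\<forall>k. p k < q k \<and> q k < p (k + 1) \<and>
     (\<forall>r>p k. h r < h (p k)) \<and> (\<forall>r\<ge>q k. h r \<le> h (p (k + 1))) \<and>
     (\<forall>r>q k. lift3 h (q k) < lift3 h r) \<and> (\<forall>r\<ge>p k. lift3 h (q k) \<le> lift3 h r))"

lemma interlacedD:
  assumes "interlaced h p q"
  shows "p k < q k" "q k < p (k + 1)"
    and "p k < r \<Longrightarrow> h r < h (p k)" "q k \<le> r \<Longrightarrow> h r \<le> h (p (k + 1))"
    and "q k < r \<Longrightarrow> lift3 h (q k) < lift3 h r" "p k \<le> r \<Longrightarrow> lift3 h (q k) \<le> lift3 h r"
  using assms unfolding interlaced_def by blast+

lemma associated_imp_interlaced:
  assumes "associated h p q"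
  shows "interlaced h p q"
proof -
  obtain a b where a: "enumerates a (A_set h)" and b: "enumerates b (B_set h)"
    and p: "enumerates p {a j | j. \<exists>c\<in>B_set h. a (j - 1) < c \<and> c < a j}"
    and q: "enumerates q {b j | j. \<exists>c\<in>A_set h. b (j - 1) < c \<and> c < b j}"
    and pq: "\<And>k. p k < q k" "\<And>k. q k < p (k + 1)"
    using assms unfolding associated_def by blast
  have pA: "p k \<in> A_set h" for k
    using a p unfolding enumerates_def by blast
  have qB: "q k \<in> B_set h" for k
    using b q unfolding enumerates_def by blast
  have BA: "B_set h \<inter> A_set h = {}" using A_set_Int_B_set by blast
  have nextA: "p (k + 1) \<le> y" if "y \<in> A_set h" "q k \<le> y" for k y
    using run_starts_next[OF a p A_set_Int_B_set qB pq(1) that] .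
  \<comment> \<open>The label preceding \<open>p k\<close> is \<open>q (k - 1)\<close>, so the run
    start after \<open>p k\<close> bears index k.\<close>
  have nextB: "q k \<le> y" if "y \<in> B_set h" "p k \<le> y" for k y
    using run_starts_next[OF b q BA pA, of "k - 1" k y] pq(2)[of "k - 1"] that by simp
  show ?thesis
    unfolding interlaced_def
    using pq pA qB le_of_no_A_set[OF pA nextA] ge_of_no_B_set[OF qB nextB]
    by (auto simp: mem_A_set_iff mem_B_set_iff)
qed

text \<open>A point y of \<open>A_set h\<close> in [q k, p (k + 1)) would have
  \<open>h (p (k + 1)) < h y\<close>, against the maximality at \<open>p (k + 1)\<close>; similarly
  for \<open>B_set h\<close>. So each label is the first point of its set after the preceding
  label.\<close>

lemma interlaced_imp_associated:
  assumes "interlaced h p q"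
  shows "associated h p q"
proof -
  note I = interlacedD[OF assms]
  have pA: "p k \<in> A_set h" for k by (simp add: mem_A_set_iff I(3))
  have qB: "q k \<in> B_set h" for k by (simp add: mem_B_set_iff I(5))
  have nextA: "p (k + 1) \<le> y" if "y \<in> A_set h" "q k \<le> y" for k y
    using I(4)[OF that(2)] that(1) by (metis mem_A_set_iff not_le)
  have nextB: "q k \<le> y" if "y \<in> B_set h" "p k \<le> y" for k y
    using I(6)[OF that(2)] that(1) by (metis mem_B_set_iff not_le)
  have mp: "strict_mono p" by (rule strict_mono_intI) (use I(1,2) less_trans in blast)
  have mq: "strict_mono q"
    by (rule strict_mono_intI) (use I(1,2) less_trans in blast)
  have "\<exists>a. enumerates a (A_set h)"
    by (rule enumerates_exists) (meson strict_mono_int_locate[OF mp] pA less_imp_le)+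
  then obtain a where a: "enumerates a (A_set h)" ..
  have "\<exists>b. enumerates b (B_set h)"
    by (rule enumerates_exists) (meson strict_mono_int_locate[OF mq] qB less_imp_le)+
  then obtain b where b: "enumerates b (B_set h)" ..
  have "enumerates p {a j | j. \<exists>c\<in>B_set h. a (j - 1) < c \<and> c < a j}"
    by (rule enumerates_run_starts[where u = p and v = q, OF a pA qB I(1,2) nextA nextB])
  moreover have "enumerates q {b j | j. \<exists>c\<in>A_set h. b (j - 1) < c \<and> c < b j}"
    \<comment> \<open>With the roles exchanged, the point following \<open>q k\<close> is
      \<open>p (k + 1)\<close>, hence the shifted companion sequence.\<close>
    by (rule enumerates_run_starts[where u = q and v = "\<lambda>k. p (k + 1)", OF b qB pA I(2) I(1) nextB nextA])
  ultimately show ?thesis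
    unfolding associated_def using a b I(1,2) by blast
qed

section \<open>Height profiles under the dynamics\<close>

text \<open>Only the increments are kept: the normalization \<open>h 0 = 0\<close> need not persist
  in time.\<close>

definition profile :: "config \<Rightarrow> (int \<Rightarrow> int) \<Rightarrow> bool" where
  "profile \<eta> h \<longleftrightarrow> (\<forall>k. h k - h (k - 1) = (if \<eta> k then - 1 else 1))"

lemma profileD: "profile \<eta> h \<Longrightarrow> h k = h (k - 1) + (if \<eta> k then - 1 else 1)"
  unfolding profile_def by (metis add.commute diff_add_cancel)

lemma profile_initial: "is_initial_height \<eta> h \<Longrightarrow> profile \<eta> h"
  by (auto simp: is_initial_height_def profile_def)

text \<open>A jump from k to k + 1 raises \<open>h k\<close> alone, by 2, which exchanges the
  down-step at k with the up-step at k + 1. The frame shift is applied afterwards.\<close>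

lemma profile_step:
  assumes "profile \<eta> h"
  shows "profile (frame_step \<eta>) (frame_height_step \<eta> h)"
proof -
  have "height_jump \<eta> h k = height_jump \<eta> h (k - 1) + (if ftasep_step \<eta> k then - 1 else 1)" for k
    using profileD[OF assms, of k] by (auto simp: height_jump_def ftasep_step_def moves_def)
  from this[of "k + 2" for k] show ?thesis
    by (auto simp: profile_def frame_step_def frame_height_step_def diff_eq_eq algebra_simps)
qed

text \<open>Heights after \<open>p k\<close> stay below \<open>h (p k)\<close>, which forces two
  down-steps; \<open>lift3\<close> then changes by -6 + 2. A particle just after \<open>q k\<close>
  would lower \<open>lift3\<close> by 2, so an up-step follows \<open>q k\<close>.\<close>

lemma interlaced_gap:
  assumes "profile \<eta> h" "interlaced h p q"
  shows "lift3 h (q k) + 4 \<le> lift3 h (p k)" "h (q k) < h (p (k + 1))"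
proof -
  note I = interlacedD[OF assms(2)] and D = profileD[OF assms(1)]
  have "h (p k + 1) = h (p k) - 1"
    using I(3)[of k "p k + 1"] D[of "p k + 1"] by (auto split: if_splits)
  then have "h (p k + 2) = h (p k) - 2"
    using I(3)[of k "p k + 2"] D[of "p k + 2"] by (auto simp: add.commute split: if_splits)
  then show "lift3 h (q k) + 4 \<le> lift3 h (p k)"
    using I(6)[of k "p k + 2"] by (simp add: lift3_def)
  have "h (q k + 1) = h (q k) + 1"
    using I(5)[of k "q k + 1"] D[of "q k + 1"] by (auto simp: lift3_def split: if_splits)
  then show "h (q k) < h (p (k + 1))"
    using I(4)[of k "q k + 1"] by simp
qed

section \<open>Freezing from the right endpoint of an interval\<close>

text \<open>Since the frame moves two sites per step, a maximum of \<^term>\<open>h\<close> just after an up-step is copied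
  two sites to its left; the upper bound \<^term>\<open>\<alpha>\<close> then forces an up-step there too.\<close>

lemma freeze_before_p:
  assumes prof: "\<And>t. profile (\<eta> t) (h t)"
    and step: "\<And>t. h (Suc t) = frame_height_step (\<eta> t) (h t)"
    and top: "\<And>t. T \<le> t \<Longrightarrow> h t P = \<alpha>"
    and le: "\<And>t r. T \<le> t \<Longrightarrow> Q \<le> r \<Longrightarrow> h t r \<le> \<alpha>"
  shows "T + s \<le> t \<Longrightarrow> Q \<le> P - 2 * int s \<Longrightarrow>
    h t (P - 2 * int s) = \<alpha> \<and> (Q < P - 2 * int s \<longrightarrow> h t (P - 2 * int s - 1) = \<alpha> - 1)"
proof (induction s arbitrary: t)
  case 0
  then show ?case
    \<comment> \<open>The bound holds only from \<open>Q\<close> on, so the site to the left is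
      controlled only if it has not passed \<open>Q\<close>.\<close>
    using top[of t] le[of t "P - 1"] profileD[OF prof, of t P]
    by (cases "Q < P") (auto split: if_splits)
next
  case (Suc s)
  define r where "r = P - 2 * int s"
  obtain t' where t': "t = Suc t'" "T + s \<le> t'" using Suc.prems(1) by (cases t) auto
  have r: "P - 2 * int (Suc s) = r - 2" "Q \<le> r - 2" using Suc.prems(2) by (auto simp: r_def)
  have IH: "h t' r = \<alpha>" "h t' (r - 1) = \<alpha> - 1" using Suc.IH[OF t'(2)] r by (auto simp: r_def)
  \<comment> \<open>With a hole at \<open>r\<close> nothing jumps from \<open>r\<close>, and the
    frame carries its height to \<open>r - 2\<close> unchanged.\<close>
  have "\<not> \<eta> t' r" using profileD[OF prof, of t' r] IH by (auto split: if_splits)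
  then have eq: "h t (r - 2) = \<alpha>"
    using IH by (simp add: t' step frame_height_step_def height_jump_def moves_def)
  then show ?case
    unfolding r(1)
    using le[of t "r - 3"] profileD[OF prof, of t "r - 2"] Suc.prems(1) by (auto split: if_splits)
qed

text \<open>Where \<open>lift3\<close> attains its minimum there are particles at \<open>r\<close>
  and \<open>r - 1\<close>. The particle at \<open>r\<close> blocks \<open>r - 1\<close>, so the
  height there, larger by one, is carried to \<open>r - 3\<close>, and \<open>lift3\<close> is
  minimal again.\<close>

lemma freeze_before_q:
  assumes prof: "\<And>t. profile (\<eta> t) (h t)"
    and step: "\<And>t. h (Suc t) = frame_height_step (\<eta> t) (h t)"
    and bot: "\<And>t. T \<le> t \<Longrightarrow> h t Q = c"
    and ge: "\<And>t r. T \<le> t \<Longrightarrow> P \<le> r \<Longrightarrow> 3 * c + Q \<le> lift3 (h t) r"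
    and gap: "\<And>t. T \<le> t \<Longrightarrow> 3 * c + Q + 4 \<le> lift3 (h t) P"
  shows "T + s \<le> t \<Longrightarrow> P \<le> Q - 3 * int s \<Longrightarrow>
    h t (Q - 3 * int s) = c + int s \<and> h t (Q - 3 * int s - 1) = c + int s + 1 \<and>
    h t (Q - 3 * int s - 2) = c + int s + 2 \<and> P \<le> Q - 3 * int s - 2"
proof (induction s arbitrary: t)
  \<comment> \<open>An up-step into \<open>r\<close> would put \<open>lift3\<close> at
    \<open>r - 1\<close> below the minimum by 4; an up-step into \<open>r - 1\<close> would put it
    at \<open>r - 2\<close> below by 2. At \<open>r\<close> and \<open>r - 1\<close> the excess over
    the minimum is 0 and 2, so the gap 4 keeps \<open>P\<close> away from both and \<open>ge\<close>
    applies.\<close>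
  have down: "h t (r - 1) = h t r + 1 \<and> h t (r - 2) = h t r + 2 \<and> P \<le> r - 2"
    if "T \<le> t" "P \<le> r" "lift3 (h t) r = 3 * c + Q" for t r
  proof -
    have "P \<noteq> r" using gap[of t] that by auto
    then have 1: "h t (r - 1) = h t r + 1"
      using that ge[of t "r - 1"] profileD[OF prof, of t r]
      by (auto simp: lift3_def split: if_splits)
    have "P \<noteq> r - 1" using gap[of t] that 1 by (auto simp: lift3_def)
    then have "h t (r - 2) = h t r + 2"
      using that \<open>P \<noteq> r\<close> 1 ge[of t "r - 2"] profileD[OF prof, of t "r - 1"]
      by (auto simp: lift3_def split: if_splits)
    with 1 \<open>P \<noteq> r\<close> \<open>P \<noteq> r - 1\<close> that show ?thesis by auto
  qed
  {
    case 0
    then show ?case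
      using bot[of t] down[of t Q] by (auto simp: lift3_def)
  next
    case (Suc s)
    define r where "r = Q - 3 * int s"
    obtain t' where t': "t = Suc t'" "T + s \<le> t'" using Suc.prems(1) by (cases t) auto
    have r: "Q - 3 * int (Suc s) = r - 3" "P \<le> r - 3" using Suc.prems(2) by (auto simp: r_def)
    have IH: "h t' r = c + int s" "h t' (r - 1) = c + int s + 1"
      using Suc.IH[OF t'(2)] r by (auto simp: r_def)
    have "\<eta> t' r" using profileD[OF prof, of t' r] IH by (auto split: if_splits)
    then have eq: "h t (r - 3) = c + int s + 1"
      using IH by (simp add: t' step frame_height_step_def height_jump_def moves_def)
    then show ?case
      unfolding r(1) using down[of t "r - 3"] Suc.prems(1) r by (auto simp: lift3_def r_def)
  }
qed

section \<open>Eventual constancy and periodic words\<close>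

lemma decseq_int_eventually_const:
  fixes f :: "nat \<Rightarrow> int"
  assumes "decseq f" "\<And>t. L \<le> f t"
  shows "\<exists>c. \<forall>\<^sub>F t in sequentially. f t = c"
proof -
  define T where "T = (ARG_MIN (\<lambda>t. nat (f t - L)) t. True)"
  have "f t = f T" if "T \<le> t" for t
  proof (rule antisym)
    show "f t \<le> f T" using assms(1) that by (simp add: decseqD)
    have "nat (f T - L) \<le> nat (f t - L)"
      unfolding T_def by (rule arg_min_nat_le) simp
    then show "f T \<le> f t" using assms(2)[of t] assms(2)[of T] by linarith
  qed
  then show ?thesis unfolding eventually_sequentially by blast
qed

lemma map_upto_replicate2:
  assumes "\<And>i. i < n \<Longrightarrow> f (a + 2 * int i) = x \<and> f (a + 2 * int i + 1) = y"
  shows "map f [a .. a + 2 * int n - 1] = concat (replicate n [x, y])"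
  using assms
proof (induction n arbitrary: a)
  case (Suc n)
  have "map f [a + 2 .. a + 2 + 2 * int n - 1] = concat (replicate n [x, y])"
    using Suc.prems[of "Suc _"] by (intro Suc.IH) (auto simp: algebra_simps)
  moreover have "[a .. a + 2 * int (Suc n) - 1] = a # (a + 1) # [a + 2 .. a + 2 + 2 * int n - 1]"
    by (simp add: upto_rec1 algebra_simps)
  ultimately show ?case using Suc.prems[of 0] by simp
qed simp

lemma map_upto_replicate3:
  assumes "\<And>i. i < n \<Longrightarrow>
    f (a + 3 * int i) = x \<and> f (a + 3 * int i + 1) = y \<and> f (a + 3 * int i + 2) = z"
  shows "map f [a .. a + 3 * int n - 1] = concat (replicate n [x, y, z])"
  using assms
proof (induction n arbitrary: a)
  case (Suc n)
  have "map f [a + 3 .. a + 3 + 3 * int n - 1] = concat (replicate n [x, y, z])"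
    using Suc.prems[of "Suc _"] by (intro Suc.IH) (auto simp: algebra_simps)
  moreover have "[a .. a + 3 * int (Suc n) - 1]
      = a # (a + 1) # (a + 2) # [a + 3 .. a + 3 + 3 * int n - 1]"
    by (simp add: upto_rec1 algebra_simps)
  ultimately show ?case using Suc.prems[of 0] by simp
qed simp

section \<open>Convergence and the limiting configuration\<close>

theorem theorem5p6:
  fixes \<rho> :: real
    and \<eta> :: "nat \<Rightarrow> config"
    and h p q :: "nat \<Rightarrow> int \<Rightarrow> int"
  assumes \<rho>: "1/2 < \<rho>" "\<rho> < 2/3"
    and \<eta>_0: "\<eta> 0 \<in> X_density \<rho>"
    and \<eta>_step: "\<And>t. \<eta> (Suc t) = frame_step (\<eta> t)"
    and h_0: "is_initial_height (\<eta> 0) (h 0)"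
    and h_step: "\<And>t. h (Suc t) = frame_height_step (\<eta> t) (h t)"
    and assoc: "\<And>t. associated (h t) (p t) (q t)"
    and labels: "\<And>t. consistent_labels (h t) (p t) (q t) (h (Suc t)) (p (Suc t)) (q (Suc t))"
  shows "\<exists>\<eta>_inf h_inf p_inf q_inf.
      (\<forall>i. \<forall>\<^sub>F t in sequentially. \<eta> t i = \<eta>_inf i) \<and>
      (\<forall>i. \<forall>\<^sub>F t in sequentially. h t i = h_inf i) \<and>
      (\<forall>k. \<forall>\<^sub>F t in sequentially. p t k = p_inf k) \<and>
      (\<forall>k. \<forall>\<^sub>F t in sequentially. q t k = q_inf k) \<and>
      associated h_inf p_inf q_inf \<and>
      (\<forall>k. \<exists>n. map \<eta>_inf [q_inf (k - 1) + 1 .. p_inf k]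
                = concat (replicate n [False, True]) @ [False]) \<and>
      (\<forall>k. \<exists>m. map \<eta>_inf [p_inf k + 1 .. q_inf k]
                = [True, True] @ concat (replicate m [False, True, True])) \<and>
      (\<forall>k. p_inf k = q 0 k - 3 * (h 0 (p 0 k) - h 0 (q 0 k)) + 4) \<and>
      (\<forall>k. real_of_int (q_inf k)
            = p 0 (k + 1) - 3 * (hstar (h 0) (p 0 (k + 1)) - hstar (h 0) (q 0 k)) + 3)"
proof -
  have prof: "profile (\<eta> t) (h t)" for t
    by (induction t) (simp_all add: profile_initial[OF h_0] \<eta>_step h_step profile_step)
  have il: "interlaced (h t) (p t) (q t)" for t
    using assoc by (rule associated_imp_interlaced)
  note I = interlacedD[OF il] and gap = interlaced_gap[OF prof il]
  \<comment> \<open>The quantities conserved by the labelling.\<close>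
  define \<alpha> where "\<alpha> k = h 0 (p 0 k)" for k
  define \<beta> where "\<beta> k = lift3 (h 0) (q 0 k)" for k
  have \<alpha>: "h t (p t k) = \<alpha> k" for t k
    by (induction t) (use labels in \<open>auto simp: \<alpha>_def consistent_labels_def\<close>)
  have \<beta>: "lift3 (h t) (q t k) = \<beta> k" for t k
    by (induction t) (use labels in \<open>auto simp: \<beta>_def consistent_labels_def hstar_lift3\<close>)

  have mono: "p (Suc t) k \<le> p t k" "q (Suc t) k \<le> q t k" for t k
    using labels[of t] by (auto simp: consistent_labels_def dest!: spec[of _ k])
  have "\<exists>c. \<forall>\<^sub>F t in sequentially. p t k = c" for k
  proof (rule decseq_int_eventually_const)
    show "decseq (\<lambda>t. p t k)"
      by (simp add: decseq_Suc_iff mono)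
    \<comment> \<open>Here \<open>gap(1)\<close> reads
      \<open>\<beta> k + 4 \<le> 3 * \<alpha> k + p t k\<close>; the bound is the limit to be
      proved.\<close>
    show "\<beta> k - 3 * \<alpha> k + 4 \<le> p t k" for t
      using gap(1)[of t k] \<alpha>[of t k] \<beta>[of t k] by (simp add: lift3_def)
  qed
  then obtain p' where p': "\<And>k. \<forall>\<^sub>F t in sequentially. p t k = p' k" by metis
  have "\<exists>c. \<forall>\<^sub>F t in sequentially. q t k = c" for k
  proof (rule decseq_int_eventually_const)
    show "decseq (\<lambda>t. q t k)"
      by (simp add: decseq_Suc_iff mono)
    show "\<beta> k - 3 * \<alpha> (k + 1) + 3 \<le> q t k" for t
      using gap(2)[of t k] \<alpha>[of t "k + 1"] \<beta>[of t k] by (simp add: lift3_def)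
  qed
  then obtain q' where q': "\<And>k. \<forall>\<^sub>F t in sequentially. q t k = q' k" by metis

  have settled: "\<exists>T. \<forall>t\<ge>T. p t k = p' k \<and> q t k = q' k \<and> p t (k + 1) = p' (k + 1)" for k
    using p'[of k] q'[of k] p'[of "k + 1"] unfolding eventually_sequentially[symmetric]
    by (intro eventually_conj)
  have pq': "p' k < q' k" "q' k < p' (k + 1)" for k
    using settled[of k] I(1,2) by (metis order_refl)+

  have before_p: "\<forall>\<^sub>F t in sequentially. h t (p' (k + 1) - 2 * int s) = \<alpha> (k + 1) \<and>
      (q' k < p' (k + 1) - 2 * int s \<longrightarrow> h t (p' (k + 1) - 2 * int s - 1) = \<alpha> (k + 1) - 1)"
    if "q' k \<le> p' (k + 1) - 2 * int s" for k s
  proof -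
    obtain T where T: "\<And>t. t \<ge> T \<Longrightarrow> p t k = p' k \<and> q t k = q' k \<and> p t (k + 1) = p' (k + 1)"
      using settled by blast
    have top: "h t (p' (k + 1)) = \<alpha> (k + 1)" if "T \<le> t" for t
      using T[OF that] \<alpha>[of t "k + 1"] by simp
    have le: "h t r \<le> \<alpha> (k + 1)" if "T \<le> t" "q' k \<le> r" for t r
      using T[OF that(1)] I(4)[of t k r] \<alpha>[of t "k + 1"] that by simp
    show ?thesis
      unfolding eventually_sequentially
      using freeze_before_p[where \<eta> = \<eta> and h = h and Q = "q' k", OF prof h_step top le] that
      by blast
  qed
  have before_q: "\<forall>\<^sub>F t in sequentially. h t (q' k - 3 * int s) = c + int s \<and>
      h t (q' k - 3 * int s - 1) = c + int s + 1 \<and>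
      h t (q' k - 3 * int s - 2) = c + int s + 2 \<and> p' k \<le> q' k - 3 * int s - 2"
    if "p' k \<le> q' k - 3 * int s" "3 * c + q' k = \<beta> k" for k s c
  proof -
    obtain T where T: "\<And>t. t \<ge> T \<Longrightarrow> p t k = p' k \<and> q t k = q' k \<and> p t (k + 1) = p' (k + 1)"
      using settled by blast
    have bot: "h t (q' k) = c" if "T \<le> t" for t
      using T[OF that] \<beta>[of t k] \<open>3 * c + q' k = \<beta> k\<close> by (simp add: lift3_def)
    have ge: "3 * c + q' k \<le> lift3 (h t) r" if "T \<le> t" "p' k \<le> r" for t r
      using T[OF that(1)] I(6)[of t k r] \<beta>[of t k] that \<open>3 * c + q' k = \<beta> k\<close> by simp
    have gap': "3 * c + q' k + 4 \<le> lift3 (h t) (p' k)" if "T \<le> t" for t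
      using T[OF that(1)] gap(1)[of t k] \<beta>[of t k] \<open>3 * c + q' k = \<beta> k\<close> by simp
    show ?thesis
      unfolding eventually_sequentially
      using freeze_before_q[where \<eta> = \<eta> and h = h, OF prof h_step bot ge gap'] that(1)
      by blast
  qed
  have level_q: "\<exists>c. 3 * c + q' k = \<beta> k" for k
    using settled[of k] \<beta>[of _ k] by (metis lift3_def order_refl)

  have mono_p': "strict_mono p'"
    by (rule strict_mono_intI) (use pq' less_trans in blast)
  have "\<exists>c. \<forall>\<^sub>F t in sequentially. h t i = c" for i
  proof -
    obtain k where k: "p' k \<le> i" "i < p' (k + 1)" using strict_mono_int_locate[OF mono_p'] .
    show ?thesis
    proof (cases "q' k \<le> i")
      case True
      \<comment> \<open>Division by the period 2 puts \<open>i\<close> at a frozen site or just left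
        of it, where the height is known as well; below, period 3 leaves three cases.\<close>
      define s where "s = nat ((p' (k + 1) - i) div 2)"
      have i: "i = p' (k + 1) - 2 * int s \<or> i = p' (k + 1) - 2 * int s - 1"
        using k by (auto simp: s_def)
      then have "q' k \<le> p' (k + 1) - 2 * int s" using True by auto
      then have "\<forall>\<^sub>F t in sequentially. h t i = \<alpha> (k + 1) - (p' (k + 1) - 2 * int s - i)"
        by (rule eventually_mono[OF before_p]) (use i True in auto)
      then show ?thesis by blast
    next
      case False
      define s where "s = nat ((q' k - i) div 3)"
      have i: "i = q' k - 3 * int s \<or> i = q' k - 3 * int s - 1 \<or> i = q' k - 3 * int s - 2"
        using False by (auto simp: s_def)
      then have le: "p' k \<le> q' k - 3 * int s" using k by auto
      obtain c where "3 * c + q' k = \<beta> k" using level_q by blast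
      then have "\<forall>\<^sub>F t in sequentially. h t i = c + int s + (q' k - 3 * int s - i)"
        by (rule eventually_mono[OF before_q[OF le]]) (use i in auto)
      then show ?thesis by blast
    qed
  qed
  then obtain h' where h': "\<And>i. \<forall>\<^sub>F t in sequentially. h t i = h' i" by metis
  define \<eta>' where "\<eta>' i \<longleftrightarrow> h' i < h' (i - 1)" for i
  have \<eta>': "\<forall>\<^sub>F t in sequentially. \<eta> t i = \<eta>' i" for i
    using h'[of i] h'[of "i - 1"]
  proof eventually_elim
    case (elim t)
    then show ?case using profileD[OF prof, of t i] by (auto simp: \<eta>'_def split: if_splits)
  qed

  \<comment> \<open>Each inequality in \<open>interlaced\<close> involves finitely many eventually
    constant values, so it is read off at one time when all of them are final.\<close>
  have snapshot: "\<exists>t. p t k = p' k \<and> q t k = q' k \<and> p t (k + 1) = p' (k + 1) \<and> h t r = h' r \<and>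
      h t (p' k) = h' (p' k) \<and> h t (q' k) = h' (q' k) \<and> h t (p' (k + 1)) = h' (p' (k + 1))" for k r
    by (rule eventually_happens'[OF sequentially_bot]) (intro eventually_conj p' q' h')
  have il': "interlaced h' p' q'"
    unfolding interlaced_def
  proof (intro allI conjI impI pq')
    fix k r
    obtain t where t: "p t k = p' k" "q t k = q' k" "p t (k + 1) = p' (k + 1)" "h t r = h' r"
      "h t (p' k) = h' (p' k)" "h t (q' k) = h' (q' k)" "h t (p' (k + 1)) = h' (p' (k + 1))"
      using snapshot by blast
    show "h' r < h' (p' k)" if "p' k < r" using I(3)[of t k r] t that by simp
    show "h' r \<le> h' (p' (k + 1))" if "q' k \<le> r" using I(4)[of t k r] t that by simp
    show "lift3 h' (q' k) < lift3 h' r" if "q' k < r"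
      using I(5)[of t k r] t that by (simp add: lift3_def)
    show "lift3 h' (q' k) \<le> lift3 h' r" if "p' k \<le> r"
      using I(6)[of t k r] t that by (simp add: lift3_def)
  qed
  have levels: "h' (p' k) = \<alpha> k" "3 * h' (q' k) + q' k = \<beta> k" "h' (q' k) < \<alpha> (k + 1)" for k
  proof -
    obtain t where t: "p t k = p' k" "q t k = q' k" "p t (k + 1) = p' (k + 1)"
      "h t (p' k) = h' (p' k)" "h t (q' k) = h' (q' k)"
      using snapshot by blast
    show "h' (p' k) = \<alpha> k" using \<alpha>[of t k] t by simp
    show "3 * h' (q' k) + q' k = \<beta> k" using \<beta>[of t k] t by (simp add: lift3_def)
    show "h' (q' k) < \<alpha> (k + 1)" using gap(2)[of t k] \<alpha>[of t "k + 1"] t by simp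
  qed
  have lim_p: "h' (p' (k + 1) - 2 * int s) = \<alpha> (k + 1) \<and>
      (q' k < p' (k + 1) - 2 * int s \<longrightarrow> h' (p' (k + 1) - 2 * int s - 1) = \<alpha> (k + 1) - 1)"
    if "q' k \<le> p' (k + 1) - 2 * int s" for k s
  proof -
    have "\<exists>t. h t (p' (k + 1) - 2 * int s) = h' (p' (k + 1) - 2 * int s) \<and>
        h t (p' (k + 1) - 2 * int s - 1) = h' (p' (k + 1) - 2 * int s - 1) \<and>
        h t (p' (k + 1) - 2 * int s) = \<alpha> (k + 1) \<and>
        (q' k < p' (k + 1) - 2 * int s \<longrightarrow> h t (p' (k + 1) - 2 * int s - 1) = \<alpha> (k + 1) - 1)"
      by (rule eventually_happens'[OF sequentially_bot]) (intro eventually_conj h' before_p that)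
    then show ?thesis by auto
  qed
  have lim_q: "h' (q' k - 3 * int s) = h' (q' k) + int s \<and>
      h' (q' k - 3 * int s - 1) = h' (q' k) + int s + 1 \<and>
      h' (q' k - 3 * int s - 2) = h' (q' k) + int s + 2 \<and> p' k \<le> q' k - 3 * int s - 2"
    if "p' k \<le> q' k - 3 * int s" for k s
  proof -
    have "\<exists>t. h t (q' k - 3 * int s) = h' (q' k - 3 * int s) \<and>
        h t (q' k - 3 * int s - 1) = h' (q' k - 3 * int s - 1) \<and>
        h t (q' k - 3 * int s - 2) = h' (q' k - 3 * int s - 2) \<and>
        h t (q' k - 3 * int s) = h' (q' k) + int s \<and>
        h t (q' k - 3 * int s - 1) = h' (q' k) + int s + 1 \<and>
        h t (q' k - 3 * int s - 2) = h' (q' k) + int s + 2 \<and> p' k \<le> q' k - 3 * int s - 2"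
      by (rule eventually_happens'[OF sequentially_bot])
        (intro eventually_conj[OF h' eventually_conj[OF h' eventually_conj[OF h' before_q]]]
          that levels)
    then show ?thesis by auto
  qed

  have hole_string: "\<exists>n. p' (k + 1) = q' k + 2 * int n + 1 \<and> h' (q' k) = \<alpha> (k + 1) - 1 \<and>
      map \<eta>' [q' k + 1 .. p' (k + 1)] = concat (replicate n [False, True]) @ [False]" for k
  proof -
    define n where "n = nat ((p' (k + 1) - q' k) div 2)"
    have "q' k \<le> p' (k + 1) - 2 * int n" using pq'[of k] by (auto simp: n_def)
    \<comment> \<open>An even distance would propagate the height \<open>\<alpha> (k + 1)\<close> to
      \<open>q' k\<close>, where the height is strictly smaller; so the distance is odd.\<close>
    moreover have "q' k \<noteq> p' (k + 1) - 2 * int n"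
      using lim_p[of k n] levels(3)[of k] by auto
    ultimately have n: "p' (k + 1) = q' k + 2 * int n + 1" using pq'[of k] by (auto simp: n_def)
    have val: "h' (q' k + 2 * int i + 1) = \<alpha> (k + 1)" "h' (q' k + 2 * int i) = \<alpha> (k + 1) - 1"
      if "i \<le> n" for i
    proof -
      have "p' (k + 1) - 2 * int (n - i) = q' k + 2 * int i + 1" using n that by simp
      then show "h' (q' k + 2 * int i + 1) = \<alpha> (k + 1)" "h' (q' k + 2 * int i) = \<alpha> (k + 1) - 1"
        using lim_p[of k "n - i"] by simp_all
    qed
    have hole: "\<not> \<eta>' (q' k + 2 * int i + 1)" if "i \<le> n" for i
      using val[OF that] by (simp add: \<eta>'_def)
    have "\<eta>' (q' k + 2 * int i + 2)" if "i < n" for i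
      using val(1)[of i] val(2)[of "Suc i"] that by (simp add: \<eta>'_def algebra_simps)
    then have "map \<eta>' [q' k + 1 .. q' k + 1 + 2 * int n - 1] = concat (replicate n [False, True])"
      using hole by (intro map_upto_replicate2) (auto simp: algebra_simps)
    moreover have "[q' k + 1 .. p' (k + 1)] = [q' k + 1 .. q' k + 1 + 2 * int n - 1] @ [p' (k + 1)]"
      using upto_rec2[of "q' k + 1" "p' (k + 1)"] by (simp add: n)
    ultimately show ?thesis
      using n hole[of n] val(2)[of 0] by (intro exI[of _ n]) simp
  qed
  have particle_string: "\<exists>m. q' k = p' k + 3 * int m + 2 \<and> \<alpha> k = h' (q' k) + int m + 2 \<and>
      map \<eta>' [p' k + 1 .. q' k] = [True, True] @ concat (replicate m [False, True, True])" for k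
  proof -
    define m where "m = nat ((q' k - p' k) div 3)"
    have "p' k \<le> q' k - 3 * int m" using pq'[of k] by (auto simp: m_def)
    \<comment> \<open>Freezing at \<open>q' k - 3 * int m\<close> leaves room for two more sites, so
      the remainder modulo 3 is 2.\<close>
    with lim_q[of k m] have m: "q' k = p' k + 3 * int m + 2" using pq'[of k] by (auto simp: m_def)
    have val: "h' (p' k + 3 * int i + 2) = h' (q' k) + int (m - i)"
      "h' (p' k + 3 * int i + 1) = h' (q' k) + int (m - i) + 1"
      "h' (p' k + 3 * int i) = h' (q' k) + int (m - i) + 2" if "i \<le> m" for i
    proof -
      have "q' k - 3 * int (m - i) = p' k + 3 * int i + 2" using m that by simp
      then show "h' (p' k + 3 * int i + 2) = h' (q' k) + int (m - i)"
        "h' (p' k + 3 * int i + 1) = h' (q' k) + int (m - i) + 1"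
        "h' (p' k + 3 * int i) = h' (q' k) + int (m - i) + 2"
        using lim_q[of k "m - i"] by (simp_all add: add.commute)
    qed
    have particles: "\<eta>' (p' k + 3 * int i + 1)" "\<eta>' (p' k + 3 * int i + 2)" if "i \<le> m" for i
      using val[OF that] by (simp_all add: \<eta>'_def algebra_simps)
    have "\<not> \<eta>' (p' k + 3 * int i + 3)" if "i < m" for i
      using val(1)[of i] val(3)[of "Suc i"] that by (simp add: \<eta>'_def algebra_simps of_nat_diff)
    \<comment> \<open>The first two particles are split off; the rest groups into triples beginning
      with a hole.\<close>
    then have "map \<eta>' [p' k + 3 .. p' k + 3 + 3 * int m - 1] = concat (replicate m [False, True, True])"
      using particles[of "Suc _"] by (intro map_upto_replicate3) (auto simp: algebra_simps)
    moreover have "[p' k + 1 .. q' k] = (p' k + 1) # (p' k + 2) # [p' k + 3 .. p' k + 3 + 3 * int m - 1]"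
      by (simp add: m upto_rec1 algebra_simps)
    ultimately show ?thesis
      using m particles[of 0] val(3)[of 0] levels(1)[of k] by (intro exI[of _ m]) simp
  qed

  have holes: "\<exists>n. map \<eta>' [q' (k - 1) + 1 .. p' k] = concat (replicate n [False, True]) @ [False]" for k
    using hole_string[of "k - 1"] by auto
  \<comment> \<open>The length and the height drop of the string share the parameter m; eliminating
    it gives \<open>p' k = \<beta> k - 3 * \<alpha> k + 4\<close>.\<close>
  have p'_eq: "p' k = q 0 k - 3 * (h 0 (p 0 k) - h 0 (q 0 k)) + 4" for k
    using particle_string[of k] levels(2)[of k] by (auto simp: \<alpha>_def \<beta>_def lift3_def)
  have q'_eq: "real_of_int (q' k)
      = p 0 (k + 1) - 3 * (hstar (h 0) (p 0 (k + 1)) - hstar (h 0) (q 0 k)) + 3" for k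
  proof -
    \<comment> \<open>The hole string fixes \<open>h' (q' k) = \<alpha> (k + 1) - 1\<close>, so the
      bound behind convergence of \<open>q\<close> is attained.\<close>
    have "q' k = \<beta> k - 3 * \<alpha> (k + 1) + 3"
      using hole_string[of k] levels(2)[of k] by auto
    then show ?thesis by (simp add: hstar_def \<alpha>_def \<beta>_def lift3_def field_simps)
  qed
  show ?thesis
    using \<eta>' h' p' q' interlaced_imp_associated[OF il'] holes particle_string p'_eq q'_eq
    by (intro exI[of _ \<eta>'] exI[of _ h'] exI[of _ p'] exI[of _ q']) blast
qed

end
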